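(* For each scientific record $\mathbf{x}$ and each $n\in\mathbb{N}$ we have $$\mathrm{Su}^{+}_{n}(\mathbf{x})=\sum_{k=1}^n\mathrm{iH}_k(\mathbf{x}).$$
   Context: Notation: $a\wedge b=\min(a,b)$, $\mathbb{N}=\{1,2,\ldots\}$. A scientific record is a sequence $\mathbf{x}=(x_1,x_2,\ldots)$ with $x_i\in\mathbb{N}\cup\{0\}$, $x_1\ge x_2\ge\ldots$ and $x_1\ge1$. It is identified with the function $i\mapsto x_i$ on $\mathbb{N}$. Let $\mu$ be the counting measure on $2^{\mathbb{N}}$. The components of the iterated $h$-index are defined by $\mathrm{iH}_0(\mathbf{x})=0$ and, for $n\in\mathbb{N}$, $$\mathrm{iH}_n(\mathbf{x})=\max_{k\in\mathbb{N}}\big\{k\wedge x_{\mathrm{iH}_0(\mathbf{x})+\ldots+\mathrm{iH}_{n-1}(\mathbf{x})+k}\big\}.$$ The upper $n$-Sugeno integral of $\mathbf{x}$ with respect to $+$ is defined recursively by $$\mathrm{Su}^{+}_{1}(\mathbf{x})=\sup_{t\in[0,\infty]}\{t\wedge\mu(\{i:x_i\ge t\})\},\qquad \mathrm{Su}^{+}_{n+1}(\mathbf{x})=\sup_{t\in[0,\infty]}\big\{(t+\mathrm{Su}^{+}_{n}(\mathbf{x}))\wedge\mu(\{i:x_i\ge t\})\big\}.$$ *)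

theory Defs
  imports "HOL-Analysis.Analysis"
begin

text \<open>A scientific record is a function on \<open>{1, 2, \<dots>}\<close>, represented by a function on
  \<^typ>\<open>nat\<close> whose value at \<open>0\<close> is never used.\<close>

definition sci_record :: "(nat \<Rightarrow> nat) \<Rightarrow> bool" where
  "sci_record x \<longleftrightarrow> (\<forall>i\<ge>1. x (Suc i) \<le> x i) \<and> x 1 \<ge> 1"

function iH :: "(nat \<Rightarrow> nat) \<Rightarrow> nat \<Rightarrow> nat" where
  "iH x 0 = 0"
| "iH x (Suc n) = Max ((\<lambda>k. min k (x ((\<Sum>j=0..n. iH x j) + k))) ` {1..})"
  by pat_completeness auto
termination
  by (relation "Wellfounded.measure snd") auto

text \<open>The maximum above is attained for every record, as it is taken over a finite nonempty set.\<close>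

lemma finite_iH_range:
  assumes "sci_record x"
  shows "finite ((\<lambda>k. min k (x (m + k))) ` {1..})"
proof -
  have "x (Suc i) \<le> x 1" for i
    using assms by (induction i) (auto simp: sci_record_def intro: order_trans)
  then have "x (m + k) \<le> x 1" if "k \<ge> 1" for k
    using that by (metis add_Suc_right One_nat_def Suc_le_D)
  then have "(\<lambda>k. min k (x (m + k))) ` {1..} \<subseteq> {..x 1}"
    by (auto simp: min.coboundedI2)
  then show ?thesis
    using finite_subset by blast
qed

definition counting :: "nat measure" where
  "counting = count_space {1..}"

text \<open>The variable \<open>t\<close> ranges over \<open>[0, \<infinity>]\<close>, which is the type \<^typ>\<open>ennreal\<close>.
  The integral is defined for \<open>n \<ge> 1\<close> only; the value at \<open>n = 0\<close> is a dummy.\<close>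

fun Su_plus :: "(nat \<Rightarrow> nat) \<Rightarrow> nat \<Rightarrow> ennreal" where
  "Su_plus x 0 = 0"
| "Su_plus x (Suc 0) =
    (SUP t. min t (emeasure counting {i \<in> {1..}. of_nat (x i) \<ge> t}))"
| "Su_plus x (Suc (Suc n)) =
    (SUP t. min (t + Su_plus x (Suc n)) (emeasure counting {i \<in> {1..}. of_nat (x i) \<ge> t}))"

end

theory Submission
  imports Defs
begin

text \<open>
  Both sides satisfy the same recursion. Let \<open>S\<close> be the sum of the first \<open>n\<close> components and
  \<open>M = iH x (Suc n)\<close>, the best value of \<open>min k (x (S + k))\<close>. The function
  \<open>t \<mapsto> t + S\<close> increases, the level-set measure \<open>t \<mapsto> \<mu> {i. x i \<ge> t}\<close> decreases, and
  their graphs cross at \<open>t = M\<close>: as \<open>x\<close> is nonincreasing, each level set is an initial segment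
  of \<open>{1, 2, \<dots>}\<close>, so maximality of \<open>M\<close> says that the level set at \<open>M\<close> has at least
  \<open>S + M\<close> elements while every higher level set has at most \<open>S + M\<close>. Hence the supremum
  of the minimum is \<open>S + M\<close>, which is \<open>Sugeno_sup_shifted\<close>; the theorem follows by
  induction on \<open>n\<close>.
\<close>

lemma sci_record_antimono:
  assumes "sci_record x" "1 \<le> i" "i \<le> j"
  shows "x j \<le> x i"
  using assms(3)
proof (induction j rule: dec_induct)
  case (step j)
  then show ?case
    using assms(1,2) by (auto simp: sci_record_def intro: order_trans)
qed simp

lemma emeasure_counting_initial_segment: "emeasure counting {1..m} = of_nat m"
  by (simp add: counting_def emeasure_count_space)

text \<open>
  One step of the recursion. The witness for the lower bound is \<open>t = M\<close>; the upper bound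
  compares with \<open>k = M + 1\<close>, the first index at which maximality of \<open>M\<close> forces
  \<open>x (S + k)\<close> itself to be at most \<open>M\<close>.
\<close>

lemma Sugeno_sup_shifted:
  fixes S :: nat
  assumes x: "sci_record x"
  defines "M \<equiv> Max ((\<lambda>k. min k (x (S + k))) ` {1..})"
  shows "(SUP t. min (t + of_nat S) (emeasure counting {i \<in> {1..}. of_nat (x i) \<ge> t}))
    = (of_nat (S + M) :: ennreal)" (is "(SUP t. min _ (emeasure _ (?L t))) = _")
proof (rule antisym)
  note fin = finite_iH_range[OF x, of S]
  have maximal: "min k (x (S + k)) \<le> M" if "k \<ge> 1" for k
    unfolding M_def by (rule Max_ge[OF fin]) (use that in auto)
  show "(SUP t. min (t + of_nat S) (emeasure counting (?L t))) \<le> of_nat (S + M)"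
  proof (rule SUP_least)
    fix t :: ennreal
    show "min (t + of_nat S) (emeasure counting (?L t)) \<le> of_nat (S + M)"
    proof (cases "t \<le> of_nat M")
      case True
      then have "t + of_nat S \<le> of_nat (S + M)"
        by (simp add: add.commute add_mono)
      then show ?thesis
        by (rule min.coboundedI1)
    next
      case False
      have drop: "x (S + M + 1) \<le> M"
        using maximal[of "M + 1"] by (simp add: min_def split: if_splits)
      have "?L t \<subseteq> {1..S + M}"
      proof
        fix i assume i: "i \<in> ?L t"
        have "i \<le> S + M"
        proof (rule ccontr)
          assume "\<not> i \<le> S + M"
          then have "x i \<le> M"
            using sci_record_antimono[OF x, of "S + M + 1" i] drop by simp
          then have "(of_nat (x i) :: ennreal) \<le> of_nat M"
            by (rule of_nat_mono)
          moreover have "t \<le> of_nat (x i)"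
            using i by simp
          ultimately show False
            using False order_trans by blast
        qed
        with i show "i \<in> {1..S + M}"
          by simp
      qed
      then have "emeasure counting (?L t) \<le> emeasure counting {1..S + M}"
        by (intro emeasure_mono) (auto simp: counting_def)
      then show ?thesis
        by (simp only: emeasure_counting_initial_segment min.coboundedI2)
    qed
  qed
  have "M \<in> (\<lambda>k. min k (x (S + k))) ` {1..}"
    unfolding M_def by (rule Max_in[OF fin]) auto
  then obtain k where k: "k \<ge> 1" "M = min k (x (S + k))"
    by auto
  have "{1..S + M} \<subseteq> ?L (of_nat M)"
  proof
    fix i assume i: "i \<in> {1..S + M}"
    then have "x (S + k) \<le> x i"
      using k by (intro sci_record_antimono[OF x]) auto
    with i k show "i \<in> ?L (of_nat M)"
      by auto
  qed
  then have "emeasure counting {1..S + M} \<le> emeasure counting (?L (of_nat M))"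
    by (intro emeasure_mono) (auto simp: counting_def)
  then have "of_nat (S + M) \<le> emeasure counting (?L (of_nat M))"
    by (simp only: emeasure_counting_initial_segment)
  then have "of_nat (S + M) \<le> min (of_nat M + of_nat S) (emeasure counting (?L (of_nat M)))"
    by (simp add: add.commute)
  then show "of_nat (S + M) \<le> (SUP t. min (t + of_nat S) (emeasure counting (?L t)))"
    by (rule SUP_upper2[OF UNIV_I])
qed

text \<open>
  The dummy value \<open>Su_plus x 0 = 0\<close> makes the base case of the integral an instance of the
  general recursion, so that the induction can start at \<open>0\<close>.
\<close>

lemma Su_plus_Suc:
  "Su_plus x (Suc n) =
    (SUP t. min (t + Su_plus x n) (emeasure counting {i \<in> {1..}. of_nat (x i) \<ge> t}))"
  by (cases n) simp_all

theorem proposition5p6: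
  fixes x :: "nat \<Rightarrow> nat" and n :: nat
  assumes "sci_record x" and "n \<ge> 1"
  shows "Su_plus x n = of_nat (\<Sum>k=1..n. iH x k)"
proof (induction n)
  case 0
  show ?case by simp
next
  case (Suc n)
  have sums: "(\<Sum>j=0..n. iH x j) = (\<Sum>k=1..n. iH x k)"
    by (simp add: sum.atLeast_Suc_atMost)
  show ?case
    unfolding Su_plus_Suc Suc.IH Sugeno_sup_shifted[OF assms(1)]
    by (simp only: iH.simps(2)[of x n] sums sum.nat_ivl_Suc' One_nat_def Suc_le_mono le0
        add.commute)
qed

end
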